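(* Let $\mathcal S_1,\dots,\mathcal S_K$ be different linear subspaces of $\mathbb{R}^m$. For $k=1,\dots,K$ let the columns of $X_k$ be randomly chosen from $\mathcal S_k$, where the number $n_k$ of columns of $X_k$ satisfies $n_k>\dim(\mathcal S_k)$, and let $X=[X_1,\dots,X_K]$. Then, with probability $1$, the segmentation $\{X_1,\dots,X_K\}$ of $X$ is intersected nondegenerately and satisfies the non-intersection condition: no column $x_j$ of $X$ lies in $\mathrm{span}(X_k)\cap\mathrm{span}(X_\ell)$ for any $k\ne\ell$.
   Context: A real matrix is identified with the finite set of its columns; a subset is a column submatrix. $r(X')$ denotes the rank of $X'$, and $\mathrm{span}(X')$ its column space. $X\setminus X'$ denotes the remaining columns of $X$ after removing $X'$. A set $X'$ is nondegenerate if every subset of $X'$ with rank smaller than $r(X')$ is of full column rank. "Randomly chosen from $\mathcal S_k$" is used in this sense: if $U_k$ is a matrix whose columns form an orthonormal basis of $\mathcal S_k$ and $X_k=U_kH_k$, then $H_k$ is a random matrix whose entries are i.i.d. (with a matrix with such i.i.d. entries being regarded as of full rank with probability 1). A segmentation $\{X_1,\dots,X_K\}$ of $X$ is intersected nondegenerately if for every $k$ and every subset $X_k'$ of $X\setminus X_k$, the following holds: put $\mathcal S_k'=\mathrm{span}(X_k)\cap\mathrm{span}(X_k')$ and let $\mathcal S_k''$ be the orthogonal complement of $\mathcal S_k'$ within $\mathrm{span}(X_k)$; split $X_k=Y_k+Z_k$ columnwise according to $\mathrm{span}(X_k)=\mathcal S_k'\oplus\mathcal S_k''$, with the columns of $Y_k$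 in $\mathcal S_k'$ and those of $Z_k$ in $\mathcal S_k''$; then $Z_k$ is either zero or nondegenerate.
   Formalization: The non-intersection condition is claimed only when no subspace S_k is contained in another S_l (it fails, e.g., for a line inside a plane); intersected nondegeneracy is claimed for all different subspaces, and the random choices for different k are taken to be independent. *)

theory Defs
  imports "HOL-Probability.Probability"
begin

text \<open>
  A real matrix is a family of columns \<open>x\<close> together with a finite set of column indices \<open>I\<close>, and a
  column submatrix is given by a subset of \<open>I\<close>. Working with indices instead of the bare set of
  column vectors keeps repeated columns apart, as full column rank requires.
\<close>

definition col_rank :: "('i \<Rightarrow> 'a::euclidean_space) \<Rightarrow> 'i set \<Rightarrow> nat" where
  "col_rank x I = dim (span (x ` I))"

definition full_column_rank :: "('i \<Rightarrow> 'a::euclidean_space) \<Rightarrow> 'i set \<Rightarrow> bool" where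
  "full_column_rank x I \<longleftrightarrow> col_rank x I = card I"

definition nondegenerate :: "('i \<Rightarrow> 'a::euclidean_space) \<Rightarrow> 'i set \<Rightarrow> bool" where
  "nondegenerate x I \<longleftrightarrow>
     (\<forall>J\<subseteq>I. col_rank x J < col_rank x I \<longrightarrow> full_column_rank x J)"

definition orth_compl_within :: "'a::euclidean_space set \<Rightarrow> 'a set \<Rightarrow> 'a set" where
  "orth_compl_within V W = {v \<in> V. \<forall>w\<in>W. orthogonal v w}"

text \<open>
  A segmentation of a matrix \<open>x\<close> into \<open>K\<close> parts is a family \<open>P\<close> of pairwise disjoint index sets, the
  columns of \<open>x\<close> being indexed by \<open>\<Union>l<K. P l\<close>. The columns \<open>y c\<close> and \<open>z c\<close> below
  exist and are unique, because \<open>span (x ` P k)\<close> is the direct sum of \<open>S'\<close> and \<open>S''\<close>.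
\<close>

definition intersected_nondegenerately ::
    "('i \<Rightarrow> 'a::euclidean_space) \<Rightarrow> nat \<Rightarrow> (nat \<Rightarrow> 'i set) \<Rightarrow> bool" where
  "intersected_nondegenerately x K P \<longleftrightarrow>
     (\<forall>k<K. \<forall>J \<subseteq> (\<Union>l<K. P l) - P k.
        let S' = span (x ` P k) \<inter> span (x ` J);
            S'' = orth_compl_within (span (x ` P k)) S'
        in \<exists>y z. (\<forall>c\<in>P k. x c = y c + z c \<and> y c \<in> S' \<and> z c \<in> S'') \<and>
                 ((\<forall>c\<in>P k. z c = 0) \<or> nondegenerate z (P k)))"

definition non_intersection ::
    "('i \<Rightarrow> 'a::euclidean_space) \<Rightarrow> nat \<Rightarrow> (nat \<Rightarrow> 'i set) \<Rightarrow> bool" where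
  "non_intersection x K P \<longleftrightarrow>
     (\<forall>k<K. \<forall>l<K. k \<noteq> l \<longrightarrow>
        (\<forall>c \<in> (\<Union>i<K. P i). x c \<notin> span (x ` P k) \<inter> span (x ` P l)))"

definition orthonormal_basis :: "nat \<Rightarrow> (nat \<Rightarrow> 'a::euclidean_space) \<Rightarrow> 'a set \<Rightarrow> bool" where
  "orthonormal_basis d u V \<longleftrightarrow>
     (\<forall>i<d. \<forall>j<d. u i \<bullet> u j = (if i = j then 1 else 0)) \<and> span (u ` {..<d}) = V"

text \<open>
  Full rank of a \<open>p \<times> q\<close> matrix whose sizes are numbers rather than types: the rows are linearly
  independent if \<open>p \<le> q\<close>, and the columns are linearly independent if \<open>q \<le> p\<close>.
\<close>

definition full_rank :: "nat \<Rightarrow> nat \<Rightarrow> (nat \<Rightarrow> nat \<Rightarrow> real) \<Rightarrow> bool" where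
  "full_rank p q A \<longleftrightarrow>
     (p \<le> q \<longrightarrow> (\<forall>c. (\<forall>j<q. (\<Sum>i<p. c i * A i j) = 0) \<longrightarrow> (\<forall>i<p. c i = 0))) \<and>
     (q \<le> p \<longrightarrow> (\<forall>c. (\<forall>i<p. (\<Sum>j<q. A i j * c j) = 0) \<longrightarrow> (\<forall>j<q. c j = 0)))"

text \<open>
  The matrices \<open>X\<^sub>k = U\<^sub>k H\<^sub>k\<close> for \<open>k < K\<close>, with column \<open>j\<close> of \<open>X\<^sub>k\<close> stored as \<open>X \<omega> (k, j)\<close> and
  entry \<open>(i, j)\<close> of \<open>H\<^sub>k\<close> being the random variable \<open>H k i j\<close>. All entries of all the \<open>H\<^sub>k\<close> are
  independent, and the entries within one \<open>H\<^sub>k\<close> share a law, which may depend on \<open>k\<close>. The law is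
  not assumed to have a density: the last conjunct is the only regularity requirement.
\<close>

definition randomly_chosen ::
    "'w measure \<Rightarrow> nat \<Rightarrow> (nat \<Rightarrow> 'a::euclidean_space set) \<Rightarrow> (nat \<Rightarrow> nat) \<Rightarrow>
     (nat \<Rightarrow> nat \<Rightarrow> 'a) \<Rightarrow> (nat \<Rightarrow> nat \<Rightarrow> nat \<Rightarrow> 'w \<Rightarrow> real) \<Rightarrow> ('w \<Rightarrow> nat \<times> nat \<Rightarrow> 'a) \<Rightarrow> bool" where
  "randomly_chosen M K S n U H X \<longleftrightarrow>
     (\<forall>k<K. orthonormal_basis (dim (S k)) (U k) (S k)) \<and>
     (\<forall>\<omega>\<in>space M. \<forall>k<K. \<forall>j<n k. X \<omega> (k, j) = (\<Sum>i<dim (S k). H k i j \<omega> *\<^sub>R U k i)) \<and>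
     prob_space.indep_vars M (\<lambda>_. borel) (\<lambda>(k, i, j). H k i j)
       {(k, i, j). k < K \<and> i < dim (S k) \<and> j < n k} \<and>
     (\<forall>k<K. \<forall>i<dim (S k). \<forall>j<n k. \<forall>i'<dim (S k). \<forall>j'<n k.
        distr M borel (H k i j) = distr M borel (H k i' j')) \<and>
     (\<forall>k<K. AE \<omega> in M. full_rank (dim (S k)) (n k) (\<lambda>i j. H k i j \<omega>))"

end

theory Submission
  imports Defs
begin

text \<open>
  Full rank with probability one forces the common law of the entries of \<open>H k\<close> to have no atoms if
  \<open>dim (S k) \<ge> 2\<close>, and no atom at \<open>0\<close> if \<open>dim (S k) = 1\<close>: otherwise all entries would coincide
  with positive probability. Fix a column \<open>c\<close> of block \<open>k\<close> and a set \<open>L\<close> of other columns. If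
  \<open>S k\<close> is not contained in the span of \<open>L\<close>, some basis vector \<open>U k i\<close> lies outside that span, so
  when all other entries are frozen at most one value of the \<open>i\<close>-th coefficient of \<open>c\<close> puts \<open>c\<close>
  into the span of \<open>L\<close>. Hence almost surely, for all \<open>c\<close> and \<open>L\<close>, the span of \<open>L\<close> contains \<open>c\<close>
  only if it contains all of \<open>S k\<close>, and both claims follow from this property by linear algebra.
\<close>

section \<open>Linear algebra of generic columns\<close>

text \<open>Columns are added one at a time: either each new one leaves the span of the earlier
  ones, which adds up to full rank, or one falls into it and \<open>V\<close> stays in the span from
  then on. \<open>V\<close> will be \<open>S k\<close> for the columns \<open>x c\<close>, and the
  set of all \<open>z c\<close> of the block for their components \<open>z c\<close>.\<close>

lemma full_column_rank_or_subset_span: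
  assumes "finite T"
    and "\<And>c R. c \<in> T \<Longrightarrow> R \<subseteq> T \<Longrightarrow> c \<notin> R \<Longrightarrow> z c \<in> span (z ` R) \<Longrightarrow> V \<subseteq> span (z ` R)"
  shows "full_column_rank z T \<or> V \<subseteq> span (z ` T)"
  using assms
proof (induction T rule: finite_induct)
  case empty
  then show ?case by (simp add: full_column_rank_def col_rank_def)
next
  case (insert c T)
  have mono: "span (z ` T) \<subseteq> span (z ` insert c T)"
    by (intro span_mono) auto
  have "full_column_rank z T \<or> V \<subseteq> span (z ` T)"
    by (rule insert.IH) (use insert.prems in blast)
  moreover have "V \<subseteq> span (z ` T)" if "z c \<in> span (z ` T)"
    using insert.prems[of c T] insert.hyps that by blast
  moreover have "full_column_rank z (insert c T)" if "full_column_rank z T" "z c \<notin> span (z ` T)"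
    using that insert.hyps by (simp add: full_column_rank_def col_rank_def dim_insert)
  ultimately show ?case using mono by blast
qed

text \<open>All that the linear algebra takes from randomness, stated for a fixed matrix so that
  probability enters only in showing that it holds almost surely.\<close>

definition generic_columns ::
    "nat \<Rightarrow> (nat \<Rightarrow> 'a::euclidean_space set) \<Rightarrow> (nat \<Rightarrow> 'i set) \<Rightarrow> ('i \<Rightarrow> 'a) \<Rightarrow> bool" where
  "generic_columns K S P x \<longleftrightarrow>
     (\<forall>k<K. \<forall>c\<in>P k. x c \<in> S k \<and>
        (\<forall>L\<subseteq>\<Union>l<K. P l. c \<notin> L \<longrightarrow> x c \<in> span (x ` L) \<longrightarrow> S k \<subseteq> span (x ` L)))"

lemma generic_columnsD:
  assumes "generic_columns K S P x" "k < K" "c \<in> P k"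
  shows "x c \<in> S k"
    and "L \<subseteq> (\<Union>l<K. P l) \<Longrightarrow> c \<notin> L \<Longrightarrow> x c \<in> span (x ` L) \<Longrightarrow> S k \<subseteq> span (x ` L)"
  using assms unfolding generic_columns_def by blast+

text \<open>More than \<open>dim (S k)\<close> columns inside \<open>S k\<close> cannot be
  independent, which leaves the second alternative of
  \<open>full_column_rank_or_subset_span\<close>.\<close>

lemma generic_columns_span:
  assumes gen: "generic_columns K S P x" and k: "k < K" and sub: "subspace (S k)"
    and fin: "finite (P k)" and card: "dim (S k) < card (P k)"
  shows "span (x ` P k) = S k"
proof
  show le: "span (x ` P k) \<subseteq> S k"
    using generic_columnsD(1)[OF gen k] sub by (intro span_minimal) auto
  have "full_column_rank x (P k) \<or> S k \<subseteq> span (x ` P k)"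
  proof (rule full_column_rank_or_subset_span[OF fin])
    fix c R assume "c \<in> P k" "R \<subseteq> P k" "c \<notin> R" "x c \<in> span (x ` R)"
    then show "S k \<subseteq> span (x ` R)"
      using generic_columnsD(2)[OF gen k, of c R] k by blast
  qed
  moreover have "\<not> full_column_rank x (P k)"
    using dim_subset[OF le] card by (simp add: full_column_rank_def col_rank_def)
  ultimately show "S k \<subseteq> span (x ` P k)" by blast
qed

text \<open>Each \<open>y a\<close> lies in the span of \<open>J\<close>, so a dependence of
  \<open>z c\<close> on \<open>R\<close> is a dependence of \<open>x c\<close> on \<open>J\<close>
  and \<open>R\<close> together. By genericity these span \<open>S k\<close>, and removing the part
  in \<open>S'\<close> shows that \<open>R\<close> alone spans all columns of \<open>z\<close>.
  Hence a \<open>T\<close> of smaller rank admits no dependence.\<close>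

lemma generic_columns_nondegenerate:
  fixes x y z :: "'i \<Rightarrow> 'a::euclidean_space"
  assumes gen: "generic_columns K S P x" and k: "k < K" and sub: "subspace (S k)"
    and fin: "finite (P k)" and J: "J \<subseteq> (\<Union>l<K. P l) - P k"
    and S': "S' = S k \<inter> span (x ` J)"
    and dec: "\<And>c. c \<in> P k \<Longrightarrow> x c = y c + z c \<and> y c \<in> S' \<and> z c \<in> orth_compl_within (S k) S'"
  shows "nondegenerate z (P k)"
  unfolding nondegenerate_def
proof (intro allI impI)
  fix T assume T: "T \<subseteq> P k" and less: "col_rank z T < col_rank z (P k)"
  have "subspace S'"
    unfolding S' by (intro subspace_inter sub subspace_span)
  have "full_column_rank z T \<or> z ` P k \<subseteq> span (z ` T)"
  proof (rule full_column_rank_or_subset_span[OF finite_subset[OF T fin]])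
    fix c R assume c: "c \<in> T" and R: "R \<subseteq> T" and "c \<notin> R" and zc: "z c \<in> span (z ` R)"
    let ?L = "J \<union> R"
    have RP: "R \<subseteq> P k" using R T by blast
    have yL: "y a \<in> span (x ` ?L)" if "a \<in> P k" for a
      using dec[OF that] span_mono[of "x ` J" "x ` ?L"] unfolding S' by blast
    have "z ` R \<subseteq> span (x ` ?L)"
    proof safe
      fix a assume a: "a \<in> R"
      then have "x a - y a \<in> span (x ` ?L)"
        using RP yL[of a] by (intro span_diff[OF span_base]) auto
      moreover have "x a - y a = z a" using a RP dec[of a] by auto
      ultimately show "z a \<in> span (x ` ?L)" by simp
    qed
    then have "span (z ` R) \<subseteq> span (x ` ?L)"
      by (simp add: span_minimal)
    then have "y c + z c \<in> span (x ` ?L)"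
      using yL[of c] zc c T by (intro span_add) blast+
    then have "x c \<in> span (x ` ?L)"
      using dec[of c] c T by auto
    then have SL: "S k \<subseteq> span (x ` ?L)"
      using generic_columnsD(2)[OF gen k, of c ?L] c T J RP k \<open>c \<notin> R\<close> by blast
    \<comment> \<open>Passing from the columns \<open>x a\<close> to \<open>z a\<close> costs only
      vectors of \<open>S'\<close>.\<close>
    have S_decomp: "\<exists>b'\<in>span (z ` R). \<exists>s\<in>S'. b = b' + s" if "b \<in> span (x ` R)" for b
    proof -
      have "x ` R \<subseteq> {b' + s |b' s. b' \<in> span (z ` R) \<and> s \<in> S'}"
        using RP dec by (force intro: span_base simp: add.commute)
      moreover have "subspace {b' + s |b' s. b' \<in> span (z ` R) \<and> s \<in> S'}"
        by (intro subspace_sums subspace_span \<open>subspace S'\<close>)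
      ultimately show ?thesis using that span_minimal by blast
    qed
    have xRS: "span (x ` R) \<subseteq> S k"
      using generic_columnsD(1)[OF gen k] sub RP by (intro span_minimal) auto
    show "z ` P k \<subseteq> span (z ` R)"
    proof safe
      fix c' assume "c' \<in> P k"
      then have zc': "z c' \<in> orth_compl_within (S k) S'" using dec by blast
      then have "z c' \<in> S k" by (simp add: orth_compl_within_def)
      then have "z c' \<in> span (x ` J \<union> x ` R)" using SL by (auto simp: image_Un)
      then obtain a b where ab: "z c' = a + b" "a \<in> span (x ` J)" "b \<in> span (x ` R)"
        unfolding span_Un by blast
      obtain b' s where b': "b' \<in> span (z ` R)" "s \<in> S'" "b = b' + s"
        using S_decomp[OF ab(3)] by blast
      \<comment> \<open>Both \<open>z c'\<close> and \<open>b\<close> lie in \<open>S k\<close>, so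
        the part \<open>a\<close> contributed by \<open>J\<close> does too and therefore lies in
        \<open>S'\<close>.\<close>
      have "a = z c' - b" using ab by simp
      then have "a \<in> S k"
        using subspace_diff[OF sub \<open>z c' \<in> S k\<close>] ab(3) xRS by blast
      then have "a \<in> S'" using ab unfolding S' by blast
      \<comment> \<open>\<open>w\<close> lies in \<open>S'\<close>, being \<open>a + s\<close>, and
        is orthogonal to \<open>S'\<close>, being a combination of columns of \<open>z\<close>; so
        it vanishes.\<close>
      define w where "w = z c' - b'"
      have "w = a + s" using ab b' by (simp add: w_def)
      then have wS: "w \<in> S'" using subspace_add[OF \<open>subspace S'\<close> \<open>a \<in> S'\<close>] b' by blast
      have "orthogonal w v" if "v \<in> S'" for v
      proof -
        have "orthogonal v b'"
          using RP dec that
          by (intro orthogonal_to_span[OF b'(1)])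
             (force simp: orth_compl_within_def orthogonal_commute)
        then show ?thesis
          using zc' that unfolding w_def orth_compl_within_def orthogonal_def
          by (simp add: inner_diff_left inner_commute[of b'])
      qed
      then have "w = 0" using wS orthogonal_self by blast
      then show "z c' \<in> span (z ` R)" using b' by (simp add: w_def)
    qed
  qed
  moreover have "\<not> z ` P k \<subseteq> span (z ` T)"
  proof
    assume "z ` P k \<subseteq> span (z ` T)"
    then have "span (z ` P k) \<subseteq> span (z ` T)" by (simp add: span_minimal)
    then show False using dim_subset less unfolding col_rank_def by (meson not_less)
  qed
  ultimately show "full_column_rank z T" by blast
qed

lemma generic_columns_intersected_nondegenerately:
  assumes gen: "generic_columns K S P x" and sub: "\<And>k. k < K \<Longrightarrow> subspace (S k)"
    and fin: "\<And>k. k < K \<Longrightarrow> finite (P k)" and card: "\<And>k. k < K \<Longrightarrow> dim (S k) < card (P k)"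
  shows "intersected_nondegenerately x K P"
  unfolding intersected_nondegenerately_def Let_def
proof (intro allI impI)
  fix k J assume k: "k < K" and J: "J \<subseteq> (\<Union>l<K. P l) - P k"
  have Sk: "span (x ` P k) = S k"
    by (rule generic_columns_span[OF gen k sub[OF k] fin[OF k] card[OF k]])
  let ?S' = "S k \<inter> span (x ` J)"
  have S': "subspace ?S'" by (intro subspace_inter sub k subspace_span)
  have "\<exists>y z. x c = y + z \<and> y \<in> ?S' \<and> z \<in> orth_compl_within (S k) ?S'" if c: "c \<in> P k" for c
  proof -
    \<comment> \<open>Orthogonal projection onto \<open>S'\<close>; as \<open>S'\<close> is inside
      \<open>S k\<close>, the remainder \<open>z\<close> stays in \<open>S k\<close>.\<close>
    obtain y z where yz: "y \<in> span ?S'" "\<And>w. w \<in> span ?S' \<Longrightarrow> orthogonal z w" "x c = y + z"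
      using orthogonal_subspace_decomp_exists[of ?S' "x c"] by blast
    have y: "y \<in> ?S'" using yz(1) S' by (metis span_eq_iff)
    moreover have "z = x c - y" using yz by simp
    then have "z \<in> S k"
      using subspace_diff[OF sub[OF k] generic_columnsD(1)[OF gen k c]] y by blast
    then have "z \<in> orth_compl_within (S k) ?S'"
      using yz(2) span_superset[of ?S'] unfolding orth_compl_within_def by blast
    ultimately show ?thesis using yz(3) by blast
  qed
  then obtain y z where dec:
    "\<And>c. c \<in> P k \<Longrightarrow> x c = y c + z c \<and> y c \<in> ?S' \<and> z c \<in> orth_compl_within (S k) ?S'"
    by metis
  then have "nondegenerate z (P k)"
    using generic_columns_nondegenerate[OF gen k sub[OF k] fin[OF k] J refl] by blast
  with dec show "\<exists>y z. (\<forall>c\<in>P k. x c = y c + z c \<and> y c \<in> span (x ` P k) \<inter> span (x ` J) \<and>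
      z c \<in> orth_compl_within (span (x ` P k)) (span (x ` P k) \<inter> span (x ` J))) \<and>
      ((\<forall>c\<in>P k. z c = 0) \<or> nondegenerate z (P k))"
    unfolding Sk by blast
qed

text \<open>A column belongs to some block \<open>i\<close>, and at least one of \<open>k\<close>
  and \<open>l\<close> differs from \<open>i\<close>. Lying in the span of that other block would
  force \<open>S i\<close> into its subspace.\<close>

lemma generic_columns_non_intersection:
  assumes gen: "generic_columns K S P x" and sub: "\<And>k. k < K \<Longrightarrow> subspace (S k)"
    and fin: "\<And>k. k < K \<Longrightarrow> finite (P k)" and card: "\<And>k. k < K \<Longrightarrow> dim (S k) < card (P k)"
    and disj: "\<And>k l. k < K \<Longrightarrow> l < K \<Longrightarrow> k \<noteq> l \<Longrightarrow> P k \<inter> P l = {}"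
    and nsub: "\<And>k l. k < K \<Longrightarrow> l < K \<Longrightarrow> k \<noteq> l \<Longrightarrow> \<not> S k \<subseteq> S l"
  shows "non_intersection x K P"
proof -
  have notin: "x c \<notin> span (x ` P l)" if "i < K" "l < K" "i \<noteq> l" "c \<in> P i" for c i l
  proof
    assume "x c \<in> span (x ` P l)"
    then have "S i \<subseteq> span (x ` P l)"
      using generic_columnsD(2)[OF gen that(1,4), of "P l"] that disj[of i l] by blast
    then show False
      using nsub[of i l] that generic_columns_span[OF gen that(2) sub fin card] by blast
  qed
  show ?thesis
    unfolding non_intersection_def
  proof (intro allI impI ballI)
    fix k l c assume kl: "k < K" "l < K" "k \<noteq> l" and "c \<in> (\<Union>i<K. P i)"
    then obtain i where "i < K" "c \<in> P i" by blast
    then show "x c \<notin> span (x ` P k) \<inter> span (x ` P l)"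
      using notin[of i k c] notin[of i l c] kl by blast
  qed
qed

section \<open>Avoiding the span of random vectors\<close>

text \<open>
  Gram--Schmidt reduction of a vector modulo a list. The junk value \<open>x / 0 = 0\<close> is what makes
  linearly dependent lists harmless.
\<close>

fun residual :: "'a::euclidean_space list \<Rightarrow> 'a \<Rightarrow> 'a" where
  "residual [] v = v"
| "residual (b # bs) v =
     residual bs v - ((residual bs v \<bullet> residual bs b) / (residual bs b \<bullet> residual bs b)) *\<^sub>R residual bs b"

lemma linear_residual: "linear (residual bs)"
proof (induction bs)
  case (Cons b bs)
  show ?case
    by (rule linearI)
      (simp_all add: linear_add[OF Cons.IH] linear_cmul[OF Cons.IH] inner_add_left add_divide_distrib
        scaleR_left_distrib scaleR_right_diff_distrib)
qed (simp add: linear_iff)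

lemma diff_residual_in_span: "v - residual bs v \<in> span (set bs)"
proof (induction bs arbitrary: v)
  case (Cons b bs)
  let ?t = "(residual bs v \<bullet> residual bs b) / (residual bs b \<bullet> residual bs b)"
  have sub: "span (set bs) \<subseteq> span (set (b # bs))" by (intro span_mono) auto
  \<comment> \<open>This is \<open>residual bs b\<close>, written as a difference of two vectors
    known to lie in the span.\<close>
  have "b - (b - residual bs b) \<in> span (set (b # bs))"
    by (rule span_diff[OF span_base subsetD[OF sub Cons.IH]]) simp
  then have "v - residual bs v + ?t *\<^sub>R (b - (b - residual bs b)) \<in> span (set (b # bs))"
    by (intro span_add[OF subsetD[OF sub Cons.IH]] span_scale)
  moreover have "v - residual bs v + ?t *\<^sub>R (b - (b - residual bs b)) = v - residual (b # bs) v"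
    by simp
  ultimately show ?case by metis
qed (simp add: span_zero)

lemma orthogonal_residual: "w \<in> set bs \<Longrightarrow> orthogonal (residual bs v) w"
proof (induction bs arbitrary: v w)
  case (Cons b bs)
  have orth: "orthogonal (residual bs u) w" if "w \<in> span (set bs)" for u w
    using that Cons.IH by (rule orthogonal_to_span)
  show ?case
  proof (cases "w \<in> set bs")
    case True
    then show ?thesis
      using orth[of w] span_base[of w "set bs"] by (simp add: orthogonal_def inner_diff_left)
  next
    case False
    then have w: "w = b" using Cons.prems by simp
    \<comment> \<open>\<open>b\<close> and its residual differ by a vector of the span of
      \<open>bs\<close>, to which every residual modulo \<open>bs\<close> is orthogonal.\<close>
    have "residual bs u \<bullet> b = residual bs u \<bullet> residual bs b" for u
      using orth[OF diff_residual_in_span[of b bs], of u] by (simp add: orthogonal_def inner_diff_right)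
    then have "residual (b # bs) v \<bullet> b = residual bs v \<bullet> residual bs b -
        (residual bs v \<bullet> residual bs b) / (residual bs b \<bullet> residual bs b) * (residual bs b \<bullet> residual bs b)"
      by (simp only: residual.simps inner_diff_left inner_scaleR_left)
    also have "\<dots> = 0" by (cases "residual bs b = 0") simp_all
    finally show ?thesis by (simp only: w orthogonal_def)
  qed
qed simp_all

text \<open>The residual is the component orthogonal to the span. Membership in a random span thus
  becomes the vanishing of a formula that is measurable in the spanning vectors, whatever their
  rank.\<close>

lemma residual_eq_0_iff: "residual bs v = 0 \<longleftrightarrow> v \<in> span (set bs)"
proof
  assume "residual bs v = 0"
  then show "v \<in> span (set bs)" using diff_residual_in_span[of v bs] by simp
next
  assume "v \<in> span (set bs)"
  then have "v - (v - residual bs v) \<in> span (set bs)"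
    by (rule span_diff[OF _ diff_residual_in_span])
  then have "residual bs v \<in> span (set bs)" by simp
  moreover have "orthogonal (residual bs v) w" if "w \<in> span (set bs)" for w
    using that orthogonal_residual by (rule orthogonal_to_span)
  ultimately show "residual bs v = 0" using orthogonal_self by blast
qed

lemma borel_measurable_residual:
  assumes "\<And>l. l \<in> set ls \<Longrightarrow> f l \<in> borel_measurable N" "v \<in> borel_measurable N"
  shows "(\<lambda>\<omega>. residual (map (\<lambda>l. f l \<omega>) ls) (v \<omega>)) \<in> borel_measurable N"
  using assms
proof (induction ls arbitrary: v)
  case (Cons b bs)
  have [measurable]: "(\<lambda>\<omega>. residual (map (\<lambda>l. f l \<omega>) bs) (v \<omega>)) \<in> borel_measurable N"
    "(\<lambda>\<omega>. residual (map (\<lambda>l. f l \<omega>) bs) (f b \<omega>)) \<in> borel_measurable N"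
    using Cons by auto
  show ?case by simp
qed simp

section \<open>Null events from independence and the absence of atoms\<close>

context prob_space
begin

text \<open>Independence makes the joint law a product. By Fubini the diagonal is null, since for
  each fixed value of \<open>t\<close> it contains one value of \<open>h\<close>, which is not an
  atom.\<close>

lemma AE_indep_var_neq:
  fixes h t :: "'a \<Rightarrow> real"
  assumes ind: "indep_var borel t borel h" and no_atom: "\<And>a. AE \<omega> in M. h \<omega> \<noteq> a"
  shows "AE \<omega> in M. h \<omega> \<noteq> t \<omega>"
proof -
  have [measurable]: "t \<in> borel_measurable M" "h \<in> borel_measurable M"
    using indep_var_rv1[OF ind] indep_var_rv2[OF ind] by auto
  interpret T: prob_space "distr M borel t" by (rule prob_space_distr) simp
  interpret H: prob_space "distr M borel h" by (rule prob_space_distr) simp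
  interpret TH: pair_prob_space "distr M borel t" "distr M borel h" ..
  have "AE p in distr M borel t \<Otimes>\<^sub>M distr M borel h. snd p \<noteq> fst p"
  proof (rule TH.AE_pair_measure)
    show "AE x in distr M borel t. AE y in distr M borel h. snd (x, y) \<noteq> fst (x, y)"
    proof (rule AE_I2)
      fix x
      show "AE y in distr M borel h. snd (x, y) \<noteq> fst (x, y)"
        using no_atom[of x] by (simp add: AE_distr_iff)
    qed
  qed measurable
  then have "AE p in distr M (borel \<Otimes>\<^sub>M borel) (\<lambda>\<omega>. (t \<omega>, h \<omega>)). snd p \<noteq> fst p"
    using ind unfolding indep_var_distribution_eq by metis
  then show ?thesis by (simp add: AE_distr_iff)
qed

lemma AE_notin_span:
  fixes u :: "'b::euclidean_space"
  assumes ind: "\<And>t. t \<in> borel_measurable N \<Longrightarrow> indep_var borel (t \<circ> Y) borel h"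
    and no_atom: "\<And>a. AE \<omega> in M. h \<omega> \<noteq> a"
    and fin: "finite L" and f: "\<And>l. l \<in> L \<Longrightarrow> f l \<in> borel_measurable N"
    and v: "v \<in> borel_measurable N"
  shows "AE \<omega> in M. h \<omega> *\<^sub>R u + v (Y \<omega>) \<in> span ((\<lambda>l. f l (Y \<omega>)) ` L) \<longrightarrow>
           u \<in> span ((\<lambda>l. f l (Y \<omega>)) ` L)"
proof -
  obtain ls where ls: "set ls = L" using finite_list[OF fin] by blast
  define r where "r y = residual (map (\<lambda>l. f l y) ls)" for y
  \<comment> \<open>The root of \<open>h *\<^sub>R r y u + r y (v y) = 0\<close>, found by taking
    the inner product with \<open>r y u\<close>. If \<open>r y u = 0\<close> its value is
    irrelevant, because \<open>u\<close> is then in the span.\<close>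
  define t where "t y = - (r y (v y) \<bullet> r y u) / (r y u \<bullet> r y u)" for y
  have [measurable]: "(\<lambda>y. r y (v y)) \<in> borel_measurable N" "(\<lambda>y. r y u) \<in> borel_measurable N"
    unfolding r_def using f v ls by (auto intro!: borel_measurable_residual)
  have "t \<in> borel_measurable N" unfolding t_def by measurable
  then have "AE \<omega> in M. h \<omega> \<noteq> t (Y \<omega>)"
    using AE_indep_var_neq[OF ind no_atom, of t] by simp
  then show ?thesis
  proof eventually_elim
    case (elim \<omega>)
    let ?y = "Y \<omega>"
    have r0: "r ?y w = 0 \<longleftrightarrow> w \<in> span ((\<lambda>l. f l ?y) ` L)" for w
      by (simp add: r_def residual_eq_0_iff ls)
    show ?case
    proof (rule impI, rule ccontr)
      assume "h \<omega> *\<^sub>R u + v ?y \<in> span ((\<lambda>l. f l ?y) ` L)"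
        and "u \<notin> span ((\<lambda>l. f l ?y) ` L)"
      then have 0: "r ?y (h \<omega> *\<^sub>R u + v ?y) = 0" and u: "r ?y u \<noteq> 0"
        by (simp_all add: r0)
      have "linear (r ?y)" unfolding r_def by (rule linear_residual)
      then have "h \<omega> *\<^sub>R r ?y u + r ?y (v ?y) = 0"
        using 0 by (simp add: linear_add linear_cmul)
      then have "(h \<omega> *\<^sub>R r ?y u + r ?y (v ?y)) \<bullet> r ?y u = 0" by simp
      then have "h \<omega> * (r ?y u \<bullet> r ?y u) = - (r ?y (v ?y) \<bullet> r ?y u)"
        by (simp add: inner_add_left)
      then have "h \<omega> = t ?y" using u by (simp add: t_def field_simps)
      then show False using elim by simp
    qed
  qed
qed

text \<open>All variables equal \<open>a\<close> with probability \<open>p ^ card I\<close>, where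
  \<open>p\<close> is the mass of their common law at \<open>a\<close>. This event is null and
  \<open>I\<close> is nonempty, so \<open>p = 0\<close>.\<close>

lemma AE_neq_of_AE_ex_neq:
  fixes V :: "'i \<Rightarrow> 'a \<Rightarrow> real"
  assumes ind: "indep_vars (\<lambda>_. borel) V I" and fin: "finite I" and q: "q \<in> I"
    and id: "\<And>p. p \<in> I \<Longrightarrow> distr M borel (V p) = distr M borel (V q)"
    and ex: "AE \<omega> in M. \<exists>p\<in>I. V p \<omega> \<noteq> a"
  shows "AE \<omega> in M. V q \<omega> \<noteq> a"
proof -
  have V [measurable]: "p \<in> I \<Longrightarrow> V p \<in> borel_measurable M" for p
    using ind unfolding indep_vars_def by blast
  have prob_eq: "prob (V p -` {a} \<inter> space M) = prob (V q -` {a} \<inter> space M)" if "p \<in> I" for p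
    using arg_cong[OF id[OF that], of "\<lambda>N. measure N {a}"] V[OF that] V[OF q]
    by (simp add: measure_distr)
  have "prob (V q -` {a} \<inter> space M) ^ card I = (\<Prod>p\<in>I. prob (V p -` {a} \<inter> space M))"
    by (simp add: prob_eq)
  also have "\<dots> = prob (\<Inter>p\<in>I. V p -` {a} \<inter> space M)"
    using q fin by (intro indep_varsD_finite[OF ind, symmetric]) auto
  also have "\<dots> = prob {}"
    using ex q fin V
    by (intro finite_measure_eq_AE) (auto intro!: sets.finite_INT measurable_sets elim!: eventually_mono)
  finally have "prob (V q -` {a} \<inter> space M) = 0" by simp
  moreover have "V q -` {a} \<inter> space M = {\<omega>\<in>space M. V q \<omega> = a}" by auto
  moreover have "{\<omega>\<in>space M. V q \<omega> = a} \<in> events" using V[OF q] by measurable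
  ultimately show ?thesis
    using prob_eq_0[of "{\<omega>\<in>space M. V q \<omega> = a}"] by (auto elim!: eventually_mono)
qed

end

text \<open>Two rows of a constant matrix are equal and hence dependent, whereas a single constant
  row is dependent only if it is zero. This explains the condition on \<open>d\<close> and
  \<open>a\<close>.\<close>

lemma not_full_rank_const:
  assumes "full_rank d n A" "d \<le> n" "0 < d" "d \<ge> 2 \<or> a = 0"
  shows "\<exists>i<d. \<exists>j<n. A i j \<noteq> a"
proof (rule ccontr)
  assume "\<not> ?thesis"
  then have A: "A i j = a" if "i < d" "j < n" for i j using that by blast
  \<comment> \<open>Row 0 minus row 1, with coefficient sum zero. For \<open>d = 1\<close> only
    \<open>c 0 = 1\<close> enters the sum, and the product vanishes because
    \<open>a = 0\<close>.\<close>
  define c :: "nat \<Rightarrow> real" where "c i = (if i = 0 then 1 else if i = 1 then - 1 else 0)" for i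
  have "(\<Sum>i<d. c i) * a = 0"
  proof (cases "d \<ge> 2")
    case True
    have "(\<Sum>i<d. c i) = (\<Sum>i\<in>{0, 1}. c i)"
      using True by (intro sum.mono_neutral_right) (auto simp: c_def)
    then show ?thesis by (simp add: c_def)
  qed (use assms in auto)
  then have "(\<Sum>i<d. c i * A i j) = 0" if "j < n" for j
    using A[OF _ that] by (simp add: sum_distrib_right)
  then have "c 0 = 0" using assms(1-3) unfolding full_rank_def by blast
  then show False by (simp add: c_def)
qed

section \<open>Randomly chosen columns are generic\<close>

context
  fixes M :: "'w measure"
    and K :: nat
    and S :: "nat \<Rightarrow> 'a::euclidean_space set"
    and n :: "nat \<Rightarrow> nat"
    and U :: "nat \<Rightarrow> nat \<Rightarrow> 'a"
    and H :: "nat \<Rightarrow> nat \<Rightarrow> nat \<Rightarrow> 'w \<Rightarrow> real"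
    and X :: "'w \<Rightarrow> nat \<times> nat \<Rightarrow> 'a"
  assumes M: "prob_space M"
    and sub: "\<And>k. k < K \<Longrightarrow> subspace (S k)"
    and card: "\<And>k. k < K \<Longrightarrow> dim (S k) < n k"
    and rc: "randomly_chosen M K S n U H X"
begin

interpretation prob_space M by (rule M)

lemma S_eq_span: "k < K \<Longrightarrow> S k = span (U k ` {..<dim (S k)})"
  using rc unfolding randomly_chosen_def orthonormal_basis_def by blast

lemma X_eq:
  "\<omega> \<in> space M \<Longrightarrow> k < K \<Longrightarrow> j < n k \<Longrightarrow> X \<omega> (k, j) = (\<Sum>i<dim (S k). H k i j \<omega> *\<^sub>R U k i)"
  using rc unfolding randomly_chosen_def by blast

definition entries :: "(nat \<times> nat \<times> nat) set" where
  "entries = {(k, i, j). k < K \<and> i < dim (S k) \<and> j < n k}"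

abbreviation entry :: "nat \<times> nat \<times> nat \<Rightarrow> 'w \<Rightarrow> real" where
  "entry \<equiv> \<lambda>(k, i, j). H k i j"

lemma indep_entries: "indep_vars (\<lambda>_. borel) entry entries"
  using rc unfolding randomly_chosen_def entries_def by blast

lemma AE_entry_neq:
  assumes k: "k < K" and i: "i < dim (S k)" and j: "j < n k" and a: "dim (S k) \<ge> 2 \<or> a = 0"
  shows "AE \<omega> in M. H k i j \<omega> \<noteq> a"
proof -
  let ?I = "{k} \<times> {..<dim (S k)} \<times> {..<n k}"
  have "indep_vars (\<lambda>_. borel) entry ?I"
    using k by (intro indep_vars_subset[OF indep_entries]) (auto simp: entries_def)
  moreover have "AE \<omega> in M. full_rank (dim (S k)) (n k) (\<lambda>i j. H k i j \<omega>)"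
    using rc k unfolding randomly_chosen_def by blast
  then have "AE \<omega> in M. \<exists>p\<in>?I. entry p \<omega> \<noteq> a"
  proof eventually_elim
    case (elim \<omega>)
    then show ?case
      using not_full_rank_const[OF elim _ _ a] card[OF k] i by auto
  qed
  moreover have "distr M borel (entry p) = distr M borel (entry (k, i, j))" if p: "p \<in> ?I" for p
  proof -
    obtain i' j' where p': "p = (k, i', j')" "i' < dim (S k)" "j' < n k" using p by auto
    have "distr M borel (H k i' j') = distr M borel (H k i j)"
      using rc k i j p'(2,3) unfolding randomly_chosen_def by blast
    then show ?thesis by (simp add: p'(1))
  qed
  ultimately have "AE \<omega> in M. entry (k, i, j) \<omega> \<noteq> a"
    using i j by (intro AE_neq_of_AE_ex_neq[where I = ?I]) auto
  then show ?thesis by simp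
qed

text \<open>In dimension at least 2 the entries have no atoms, and one coefficient is varied against
  all others. In dimension 1 nonzero atoms are possible, but almost surely the column is a nonzero
  multiple of the basis vector, so any span containing one contains the other.\<close>

lemma AE_column_span_basis:
  assumes k: "k < K" and i: "i < dim (S k)" and j: "j < n k"
    and L: "L \<subseteq> (\<Union>l<K. {l} \<times> {..<n l})" and notin: "(k, j) \<notin> L"
  shows "AE \<omega> in M. X \<omega> (k, j) \<in> span (X \<omega> ` L) \<longrightarrow> U k i \<in> span (X \<omega> ` L)"
proof (cases "dim (S k) \<ge> 2")
  case True
  let ?q = "(k, i, j)"
  let ?A = "entries - {?q}"
  \<comment> \<open>\<open>Y\<close> collects every entry but \<open>?q\<close>, \<open>f c\<close>
    rebuilds column \<open>c\<close> from entries, and \<open>v\<close> is column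
    \<open>(k, j)\<close> without its \<open>i\<close>-th term.\<close>
  define Y where "Y \<omega> = restrict (\<lambda>p. entry p \<omega>) ?A" for \<omega>
  define f where "f c g = (\<Sum>i<dim (S (fst c)). g (fst c, i, snd c) *\<^sub>R U (fst c) i)"
    for c and g :: "nat \<times> nat \<times> nat \<Rightarrow> real"
  define v where "v g = (\<Sum>i'\<in>{..<dim (S k)} - {i}. g (k, i', j) *\<^sub>R U k i')"
    for g :: "nat \<times> nat \<times> nat \<Rightarrow> real"
  have q: "?q \<in> entries" using k i j by (simp add: entries_def)
  have ind: "indep_var borel (t \<circ> Y) borel (H k i j)"
    if "t \<in> borel_measurable (PiM ?A (\<lambda>_. borel))" for t :: "(nat \<times> nat \<times> nat \<Rightarrow> real) \<Rightarrow> real"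
  proof -
    have "indep_var (PiM ?A (\<lambda>_. borel)) Y (PiM {?q} (\<lambda>_. borel)) (\<lambda>\<omega>. restrict (\<lambda>p. entry p \<omega>) {?q})"
      unfolding Y_def using q by (intro indep_var_restrict[OF indep_entries]) auto
    \<comment> \<open>Evaluation at \<open>?q\<close> turns the tuple with that single coordinate
      back into \<open>H k i j\<close>.\<close>
    then have "indep_var borel (t \<circ> Y) borel ((\<lambda>g. g ?q) \<circ> (\<lambda>\<omega>. restrict (\<lambda>p. entry p \<omega>) {?q}))"
      using that by (rule indep_var_compose) auto
    then show ?thesis by (simp add: comp_def)
  qed
  \<comment> \<open>No column in \<open>L\<close> involves \<open>?q\<close>, as
    \<open>(k, j)\<close> is not in \<open>L\<close>; so these columns are functions of
    \<open>Y\<close>.\<close>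
  have inA: "(l, i', j') \<in> ?A" if "(l, j') \<in> L" "i' < dim (S l)" for l i' j'
    using that L notin by (auto simp: entries_def)
  have inA': "(k, i', j) \<in> ?A" if "i' \<in> {..<dim (S k)} - {i}" for i'
    using that k j by (auto simp: entries_def)
  have comp: "(\<lambda>g. g p) \<in> borel_measurable (PiM ?A (\<lambda>_. borel :: real measure))" if "p \<in> ?A" for p
    using that by (rule measurable_component_singleton)
  have "AE \<omega> in M. H k i j \<omega> *\<^sub>R U k i + v (Y \<omega>) \<in> span ((\<lambda>c. f c (Y \<omega>)) ` L) \<longrightarrow>
      U k i \<in> span ((\<lambda>c. f c (Y \<omega>)) ` L)"
  proof (rule AE_notin_span[OF ind])
    show "AE \<omega> in M. H k i j \<omega> \<noteq> a" for a
      using AE_entry_neq[OF k i j] True by blast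
    show "finite L" using L by (rule finite_subset) auto
    show "f c \<in> borel_measurable (PiM ?A (\<lambda>_. borel))" if "c \<in> L" for c
      unfolding f_def using that
      by (intro borel_measurable_sum borel_measurable_scaleR borel_measurable_const comp inA) auto
    show "v \<in> borel_measurable (PiM ?A (\<lambda>_. borel))"
      unfolding v_def
      by (intro borel_measurable_sum borel_measurable_scaleR borel_measurable_const comp inA') auto
  qed
  moreover have "AE \<omega> in M. \<omega> \<in> space M" by simp
  ultimately show ?thesis
  proof eventually_elim
    case (elim \<omega>)
    have "f c (Y \<omega>) = X \<omega> c" if "c \<in> L" for c
    proof -
      obtain l j' where c: "c = (l, j')" by (cases c)
      then have "l < K" "j' < n l" using that L by auto
      then have "X \<omega> c = (\<Sum>i<dim (S l). H l i j' \<omega> *\<^sub>R U l i)"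
        using X_eq elim(2) c by blast
      also have "\<dots> = f c (Y \<omega>)"
        using inA that unfolding f_def c by (intro sum.cong) (auto simp: Y_def)
      finally show ?thesis by simp
    qed
    then have "(\<lambda>c. f c (Y \<omega>)) ` L = X \<omega> ` L" by (intro image_cong) auto
    moreover have "v (Y \<omega>) = (\<Sum>i'\<in>{..<dim (S k)} - {i}. H k i' j \<omega> *\<^sub>R U k i')"
      using inA' unfolding v_def by (intro sum.cong) (auto simp: Y_def)
    then have "H k i j \<omega> *\<^sub>R U k i + v (Y \<omega>) = X \<omega> (k, j)"
      using X_eq[OF elim(2) k j] i by (simp add: sum.remove[of "{..<dim (S k)}" i])
    ultimately show ?case using elim(1) by simp
  qed
next
  case False
  then have d: "dim (S k) = 1" "i = 0" using i by auto
  have "AE \<omega> in M. \<omega> \<in> space M" by simp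
  with AE_entry_neq[OF k i j, of 0, simplified] show ?thesis
  proof eventually_elim
    case (elim \<omega>)
    then have X: "X \<omega> (k, j) = H k i j \<omega> *\<^sub>R U k i"
      using X_eq[OF elim(2) k j] d by simp
    show ?case
    proof
      assume "X \<omega> (k, j) \<in> span (X \<omega> ` L)"
      then have "(1 / H k i j \<omega>) *\<^sub>R X \<omega> (k, j) \<in> span (X \<omega> ` L)" by (rule span_scale)
      then show "U k i \<in> span (X \<omega> ` L)" using elim(1) by (simp add: X)
    qed
  qed
qed

text \<open>Entries and sets \<open>L\<close> are finite in number, so the exceptional null sets can
  be united. Outside their union, a span containing a column contains the whole basis of its
  \<open>S k\<close>.\<close>

lemma AE_generic_columns: "AE \<omega> in M. generic_columns K S (\<lambda>k. {k} \<times> {..<n k}) (X \<omega>)"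
proof -
  let ?C = "\<Union>l<K. {l} \<times> {..<n l}"
  have "AE \<omega> in M. \<forall>p\<in>entries. \<forall>L\<in>Pow ?C.
      case p of (k, i, j) \<Rightarrow> (k, j) \<notin> L \<longrightarrow> X \<omega> (k, j) \<in> span (X \<omega> ` L) \<longrightarrow> U k i \<in> span (X \<omega> ` L)"
  proof (intro AE_ball_countable')
    fix p L assume p: "p \<in> entries" and L: "L \<in> Pow ?C"
    show "AE \<omega> in M. case p of (k, i, j) \<Rightarrow>
        (k, j) \<notin> L \<longrightarrow> X \<omega> (k, j) \<in> span (X \<omega> ` L) \<longrightarrow> U k i \<in> span (X \<omega> ` L)"
    proof (cases p)
      case (fields k i j)
      then have kij: "k < K" "i < dim (S k)" "j < n k" using p by (simp_all add: entries_def)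
      show ?thesis
      proof (cases "(k, j) \<in> L")
        case False
        have "AE \<omega> in M. X \<omega> (k, j) \<in> span (X \<omega> ` L) \<longrightarrow> U k i \<in> span (X \<omega> ` L)"
          by (rule AE_column_span_basis[OF kij _ False]) (use L in blast)
        then show ?thesis by (simp add: fields)
      qed (simp add: fields)
    qed
  next
    show "countable entries" by simp
    have "finite ?C" by simp
    then show "countable (Pow ?C)" by (simp add: countable_finite)
  qed
  moreover have "AE \<omega> in M. \<omega> \<in> space M" by simp
  ultimately show ?thesis
  proof eventually_elim
    case (elim \<omega>)
    show ?case
      unfolding generic_columns_def
    proof (intro allI impI ballI conjI)
      fix k c assume k: "k < K" and "c \<in> {k} \<times> {..<n k}"
      then obtain j where c: "c = (k, j)" and j: "j < n k" by auto
      have "(\<Sum>i<dim (S k). H k i j \<omega> *\<^sub>R U k i) \<in> span (U k ` {..<dim (S k)})"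
        by (intro span_sum span_scale span_base) auto
      then show "X \<omega> c \<in> S k"
        using X_eq[OF elim(2) k j] S_eq_span[OF k] c by simp
      fix L assume L: "L \<subseteq> ?C" "c \<notin> L" "X \<omega> c \<in> span (X \<omega> ` L)"
      have "U k i \<in> span (X \<omega> ` L)" if "i < dim (S k)" for i
        using elim(1) L k j that c unfolding entries_def by fastforce
      then have "span (U k ` {..<dim (S k)}) \<subseteq> span (X \<omega> ` L)"
        by (intro span_minimal) auto
      then show "S k \<subseteq> span (X \<omega> ` L)" using S_eq_span[OF k] by simp
    qed
  qed
qed

end

text \<open>Non-intersection is guarded by the absence of containments, since distinctness does not
  give it: if \<open>S k \<subseteq> S l\<close> with \<open>k \<noteq> l\<close>, then almost
  surely all columns of block \<open>k\<close> lie in the spans of both blocks.\<close>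

theorem theorem4:
  fixes M :: "'w measure"
    and K :: nat
    and S :: "nat \<Rightarrow> (real ^ 'm) set"
    and n :: "nat \<Rightarrow> nat"
    and U :: "nat \<Rightarrow> nat \<Rightarrow> real ^ 'm"
    and H :: "nat \<Rightarrow> nat \<Rightarrow> nat \<Rightarrow> 'w \<Rightarrow> real"
    and X :: "'w \<Rightarrow> nat \<times> nat \<Rightarrow> real ^ 'm"
  assumes "prob_space M"
    and "\<And>k. k < K \<Longrightarrow> subspace (S k)"
    and "inj_on S {..<K}"
    and "\<And>k. k < K \<Longrightarrow> dim (S k) < n k"
    and "randomly_chosen M K S n U H X"
  shows "AE \<omega> in M.
           intersected_nondegenerately (X \<omega>) K (\<lambda>k. {k} \<times> {..<n k}) \<and>
           ((\<forall>k<K. \<forall>l<K. k \<noteq> l \<longrightarrow> \<not> S k \<subseteq> S l) \<longrightarrow>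
              non_intersection (X \<omega>) K (\<lambda>k. {k} \<times> {..<n k}))"
proof -
  have "AE \<omega> in M. generic_columns K S (\<lambda>k. {k} \<times> {..<n k}) (X \<omega>)"
    by (rule AE_generic_columns[OF assms(1,2,4,5)])
  then show ?thesis
  proof eventually_elim
    case (elim \<omega>)
    show ?case
    proof (intro conjI impI)
      show "intersected_nondegenerately (X \<omega>) K (\<lambda>k. {k} \<times> {..<n k})"
        by (rule generic_columns_intersected_nondegenerately[OF elim])
           (use assms(2,4) in \<open>auto simp: card_cartesian_product\<close>)
      assume "\<forall>k<K. \<forall>l<K. k \<noteq> l \<longrightarrow> \<not> S k \<subseteq> S l"
      then show "non_intersection (X \<omega>) K (\<lambda>k. {k} \<times> {..<n k})"
        by (intro generic_columns_non_intersection[OF elim])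
           (use assms(2,4) in \<open>auto simp: card_cartesian_product\<close>)
    qed
  qed
qed

end
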